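(* Let $\xi\in\mathbb C/2\mathbb Z$ and $\tau\in\mathbb C$ be such that $\tau\ne(\mu+1)^2$ for all $\mu\in\xi$ and $\tau\ne0$. Let $M$ be an object of $\bar{\mathfrak M}^{\xi,\tau}$, let $\sigma:\mathfrak{sl}(2)\to\operatorname{End}(M)$ be its $\mathfrak{sl}(2)$-module structure and let $\sigma(c)$ be its Casimir operator. Let $T\in\operatorname{End}_{\mathbb C}(M)$. If $$\operatorname{ad}(\sigma(f))(T)=3\sigma(e),\qquad \operatorname{ad}(\sigma(h))(T)=4T,\qquad \operatorname{ad}(\sigma(c))(T)=0,$$ $$[T,\operatorname{ad}(\sigma(e))(T)]=-\tfrac16\operatorname{ad}(\sigma(e))^3(T),$$ then $T$ gives rise to a compatible $\mathbf{Witt}_{>}$-module structure on $M$; that is, there is a Lie algebra representation $\rho:\mathbf{Witt}_{>}\to\operatorname{End}(M)$ with $\rho(L_{-1})=\sigma(f)$, $\rho(L_0)=-\frac12\sigma(h)$, $\rho(L_1)=-\sigma(e)$ and $\rho(L_2)=T$.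
   Context: $\mathfrak{sl}(2)=\mathfrak{sl}(2,\mathbb C)$ has Chevalley basis $\{e,f,h\}$ with $[e,f]=h$, $[h,e]=2e$, $[h,f]=-2f$. $\mathbf{Witt}_{>}$ is the complex Lie algebra with basis $\{L_k\}_{k\ge-1}$ and bracket $[L_i,L_j]=(i-j)L_{i+j}$. The Casimir operator is $c=(h+1)^2+4fe$. For an $\mathfrak{sl}(2)$-module $M$ and $\lambda\in\mathbb C$, $M_\lambda=\{m\in M: hm=\lambda m\}$; $M$ is a weight module if $M=\bigoplus_\lambda M_\lambda$, and $\operatorname{supp}(M)=\{\lambda: M_\lambda\neq0\}$. A class $\xi\in\mathbb C/2\mathbb Z$ is regarded as a subset of $\mathbb C$. $\bar{\mathfrak M}^{\xi,\tau}$ is the full subcategory of $\mathfrak{sl}(2)$-modules whose objects are the weight modules $M$ with finite-dimensional weight spaces, $\operatorname{supp}(M)\subseteq\xi$, and such that $(c-\tau)|_{M_\lambda}$ is nilpotent for every $\lambda\in\xi$. $\operatorname{ad}(A)(B)=[A,B]=AB-BA$. *)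

theory Defs
  imports "HOL-Analysis.Analysis" "HOL-Library.Poly_Mapping"
begin

locale complex_lie_algebra = vector_space scale
  for scale :: "complex \<Rightarrow> 'g::ab_group_add \<Rightarrow> 'g" +
  fixes \<g> :: "'g set"
    and bracket :: "'g \<Rightarrow> 'g \<Rightarrow> 'g"
  assumes subspace_carrier: "subspace \<g>"
    and bracket_closed: "x \<in> \<g> \<Longrightarrow> y \<in> \<g> \<Longrightarrow> bracket x y \<in> \<g>"
    and bracket_add_left:
      "x \<in> \<g> \<Longrightarrow> y \<in> \<g> \<Longrightarrow> z \<in> \<g> \<Longrightarrow> bracket (x + y) z = bracket x z + bracket y z"
    and bracket_add_right:
      "x \<in> \<g> \<Longrightarrow> y \<in> \<g> \<Longrightarrow> z \<in> \<g> \<Longrightarrow> bracket x (y + z) = bracket x y + bracket x z"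
    and bracket_scale_left:
      "x \<in> \<g> \<Longrightarrow> y \<in> \<g> \<Longrightarrow> bracket (scale a x) y = scale a (bracket x y)"
    and bracket_scale_right:
      "x \<in> \<g> \<Longrightarrow> y \<in> \<g> \<Longrightarrow> bracket x (scale a y) = scale a (bracket x y)"
    and bracket_self: "x \<in> \<g> \<Longrightarrow> bracket x x = 0"
    and jacobi: "x \<in> \<g> \<Longrightarrow> y \<in> \<g> \<Longrightarrow> z \<in> \<g> \<Longrightarrow>
      bracket x (bracket y z) + bracket y (bracket z x) + bracket z (bracket x y) = 0"

definition ad :: "('m \<Rightarrow> 'm) \<Rightarrow> ('m \<Rightarrow> 'm) \<Rightarrow> ('m \<Rightarrow> 'm::ab_group_add)" where
  "ad A B = (\<lambda>m. A (B m) - B (A m))"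

text \<open>The representation space is a whole type; the values of \<open>\<rho>\<close> outside the Lie algebra
  \<open>\<g>\<close> are irrelevant.\<close>

locale lie_representation =
  complex_lie_algebra scale \<g> bracket + M: vector_space scaleM
  for scale :: "complex \<Rightarrow> 'g::ab_group_add \<Rightarrow> 'g"
    and \<g> :: "'g set"
    and bracket :: "'g \<Rightarrow> 'g \<Rightarrow> 'g"
    and scaleM :: "complex \<Rightarrow> 'm::ab_group_add \<Rightarrow> 'm" +
  fixes \<rho> :: "'g \<Rightarrow> 'm \<Rightarrow> 'm"
  assumes rep_End: "x \<in> \<g> \<Longrightarrow> Vector_Spaces.linear scaleM scaleM (\<rho> x)"
    and rep_add: "x \<in> \<g> \<Longrightarrow> y \<in> \<g> \<Longrightarrow> \<rho> (x + y) = (\<lambda>m. \<rho> x m + \<rho> y m)"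
    and rep_scale: "x \<in> \<g> \<Longrightarrow> \<rho> (scale a x) = (\<lambda>m. scaleM a (\<rho> x m))"
    and rep_bracket: "x \<in> \<g> \<Longrightarrow> y \<in> \<g> \<Longrightarrow> \<rho> (bracket x y) = ad (\<rho> x) (\<rho> y)"


definition mat_scale :: "complex \<Rightarrow> complex^2^2 \<Rightarrow> complex^2^2" where
  "mat_scale a A = (\<chi> i j. a * A $ i $ j)"

definition mat_bracket :: "complex^2^2 \<Rightarrow> complex^2^2 \<Rightarrow> complex^2^2" where
  "mat_bracket A B = A ** B - B ** A"

definition sl2 :: "(complex^2^2) set" where
  "sl2 = {A. trace A = 0}"

definition sl2_e :: "complex^2^2" where "sl2_e = vector [vector [0, 1], vector [0, 0]]"
definition sl2_f :: "complex^2^2" where "sl2_f = vector [vector [0, 0], vector [1, 0]]"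
definition sl2_h :: "complex^2^2" where "sl2_h = vector [vector [1, 0], vector [0, - 1]]"

lemma sl2_relations:
  "mat_bracket sl2_e sl2_f = sl2_h"
  "mat_bracket sl2_h sl2_e = mat_scale 2 sl2_e"
  "mat_bracket sl2_h sl2_f = mat_scale (- 2) sl2_f"
  by (simp_all add: mat_bracket_def mat_scale_def sl2_e_def sl2_f_def sl2_h_def vec_eq_iff
      forall_2 matrix_matrix_mult_def sum_2)

lemma sl2_chevalley_span:
  "sl2 = {mat_scale a sl2_e + mat_scale b sl2_f + mat_scale c sl2_h |a b c. True}"
proof -
  have "A \<in> {mat_scale a sl2_e + mat_scale b sl2_f + mat_scale c sl2_h |a b c. True}"
    if "A \<in> sl2" for A
  proof -
    have "A = mat_scale (A $ 1 $ 2) sl2_e + mat_scale (A $ 2 $ 1) sl2_f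
            + mat_scale (A $ 1 $ 1) sl2_h"
      using that by (simp add: sl2_def trace_def sum_2 mat_scale_def sl2_e_def sl2_f_def
          sl2_h_def vec_eq_iff forall_2 eq_neg_iff_add_eq_0 add.commute)
    then show ?thesis by blast
  qed
  then show ?thesis
    by (auto simp: sl2_def trace_def sum_2 mat_scale_def sl2_e_def sl2_f_def sl2_h_def)
qed

lemma sl2_lie_algebra: "complex_lie_algebra mat_scale sl2 mat_bracket"
proof -
  interpret vector_space mat_scale
    by unfold_locales (simp_all add: mat_scale_def vec_eq_iff algebra_simps)
  show ?thesis
  proof unfold_locales
    show "subspace sl2"
      by (auto simp: subspace_def sl2_def trace_add)
        (simp_all add: trace_def mat_scale_def flip: sum_distrib_left)
  qed (simp_all add: sl2_def mat_bracket_def mat_scale_def trace_def sum_2 vec_eq_iff forall_2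
      matrix_matrix_mult_def algebra_simps)
qed


text \<open>The element \<open>\<Sum>\<^sub>k x\<^sub>k L\<^sub>k\<close> is encoded by the finitely supported map \<open>k \<mapsto> x\<^sub>k\<close> on the
  integers; the positive Witt algebra consists of those supported on \<open>k \<ge> - 1\<close>.\<close>

definition witt_scale :: "complex \<Rightarrow> (int \<Rightarrow>\<^sub>0 complex) \<Rightarrow> (int \<Rightarrow>\<^sub>0 complex)" where
  "witt_scale a x = Poly_Mapping.map ((*) a) x"

definition witt_bracket ::
    "(int \<Rightarrow>\<^sub>0 complex) \<Rightarrow> (int \<Rightarrow>\<^sub>0 complex) \<Rightarrow> (int \<Rightarrow>\<^sub>0 complex)" where
  "witt_bracket x y = (\<Sum>i\<in>Poly_Mapping.keys x. \<Sum>j\<in>Poly_Mapping.keys y.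
     Poly_Mapping.single (i + j)
       (of_int (i - j) * Poly_Mapping.lookup x i * Poly_Mapping.lookup y j))"

definition witt_pos :: "(int \<Rightarrow>\<^sub>0 complex) set" where
  "witt_pos = {x. Poly_Mapping.keys x \<subseteq> {- 1..}}"

definition witt_L :: "int \<Rightarrow> (int \<Rightarrow>\<^sub>0 complex)" where
  "witt_L k = Poly_Mapping.single k 1"

lemma witt_bracket_superset:
  assumes "finite S" "Poly_Mapping.keys x \<subseteq> S" "finite R" "Poly_Mapping.keys y \<subseteq> R"
  shows "witt_bracket x y = (\<Sum>i\<in>S. \<Sum>j\<in>R. Poly_Mapping.single (i + j)
       (of_int (i - j) * Poly_Mapping.lookup x i * Poly_Mapping.lookup y j))"
proof -
  have "witt_bracket x y = (\<Sum>i\<in>Poly_Mapping.keys x. \<Sum>j\<in>R. Poly_Mapping.single (i + j)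
       (of_int (i - j) * Poly_Mapping.lookup x i * Poly_Mapping.lookup y j))"
    unfolding witt_bracket_def using assms
    by (intro sum.cong refl sum.mono_neutral_left) (auto simp: in_keys_iff)
  also have "\<dots> = (\<Sum>i\<in>S. \<Sum>j\<in>R. Poly_Mapping.single (i + j)
       (of_int (i - j) * Poly_Mapping.lookup x i * Poly_Mapping.lookup y j))"
    using assms by (intro sum.mono_neutral_left) (auto simp: in_keys_iff)
  finally show ?thesis .
qed

lemma witt_bracket_L: "witt_bracket (witt_L i) (witt_L j) = witt_scale (of_int (i - j)) (witt_L (i + j))"
  by (simp add: witt_bracket_def witt_L_def witt_scale_def keys_single map_single)

lemma witt_bracket_single: "witt_bracket (Poly_Mapping.single i a) (Poly_Mapping.single j b)
    = Poly_Mapping.single (i + j) (of_int (i - j) * a * b)"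
  by (auto simp: witt_bracket_def keys_single)

lemma witt_bracket_add_left: "witt_bracket (x + y) z = witt_bracket x z + witt_bracket y z"
proof -
  let ?S = "Poly_Mapping.keys x \<union> Poly_Mapping.keys y" and ?R = "Poly_Mapping.keys z"
  have "Poly_Mapping.keys (x + y) \<subseteq> ?S" by (rule Poly_Mapping.keys_add)
  then show ?thesis
    by (simp add: witt_bracket_superset[of ?S _ ?R] lookup_add distrib_left distrib_right
        single_add sum.distrib)
qed

lemma witt_bracket_swap: "witt_bracket y x = - witt_bracket x y"
  unfolding witt_bracket_def
  by (subst sum.swap)
    (simp add: sum_negf[symmetric] algebra_simps single_uminus[symmetric])

lemma witt_bracket_add_right: "witt_bracket z (x + y) = witt_bracket z x + witt_bracket z y"
  by (metis witt_bracket_add_left witt_bracket_swap minus_add_distrib)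

lemma lookup_witt_scale: "Poly_Mapping.lookup (witt_scale a x) k = a * Poly_Mapping.lookup x k"
  by (simp add: witt_scale_def map.rep_eq when_def)

lemma witt_scale_single: "witt_scale a (Poly_Mapping.single k b) = Poly_Mapping.single k (a * b)"
  by (rule poly_mapping_eqI) (simp add: lookup_witt_scale lookup_single when_def)

lemma witt_scale_zero [simp]: "witt_scale a 0 = 0"
  by (rule poly_mapping_eqI) (simp add: lookup_witt_scale)

lemma witt_scale_add: "witt_scale a (x + y) = witt_scale a x + witt_scale a y"
  by (rule poly_mapping_eqI) (simp add: lookup_witt_scale lookup_add algebra_simps)

lemma witt_induct [case_names zero add]:
  assumes "P 0" "\<And>k a x. P x \<Longrightarrow> P (Poly_Mapping.single k a + x)"
  shows "P (x :: int \<Rightarrow>\<^sub>0 complex)"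
proof (induction x rule: update_induct)
  case const
  then show ?case using assms(1) by simp
next
  case (update f a b)
  have "Poly_Mapping.update a b f = Poly_Mapping.single a b + f"
    using update by (intro poly_mapping_eqI)
      (auto simp: lookup_update lookup_add lookup_single when_def in_keys_iff)
  then show ?case using assms(2) update by simp
qed

lemma witt_bracket_zero [simp]: "witt_bracket 0 x = 0" "witt_bracket x 0 = 0"
  by (simp_all add: witt_bracket_def)

lemma witt_bracket_scale_left: "witt_bracket (witt_scale a x) y = witt_scale a (witt_bracket x y)"
proof (induction x rule: witt_induct)
  case zero
  show ?case by simp
next
  case (add k b x)
  have "witt_bracket (Poly_Mapping.single k (a * b)) y
    = witt_scale a (witt_bracket (Poly_Mapping.single k b) y)"
  proof (induction y rule: witt_induct)
    case zero
    show ?case by simp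
  next
    case (add l c y)
    then show ?case
      by (simp add: witt_bracket_add_right witt_scale_add witt_bracket_single witt_scale_single
          mult_ac)
  qed
  then show ?case using add
    by (simp add: witt_bracket_add_left witt_scale_add witt_scale_single)
qed

lemma witt_jacobi:
  "witt_bracket x (witt_bracket y z) + witt_bracket y (witt_bracket z x)
     + witt_bracket z (witt_bracket x y) = 0"
proof -
  define J where "J x y z = witt_bracket x (witt_bracket y z) + witt_bracket y (witt_bracket z x)
     + witt_bracket z (witt_bracket x y)" for x y z
  have J_add: "J (p + q) y z = J p y z + J q y z" "J x (p + q) z = J x p z + J x q z"
    "J x y (p + q) = J x y p + J x y q" for p q x y z
    by (simp_all add: J_def witt_bracket_add_left witt_bracket_add_right add_ac)
  have J_zero: "J 0 y z = 0" "J x 0 z = 0" "J x y 0 = 0" for x y z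
    by (simp_all add: J_def)
  have J_single: "J (Poly_Mapping.single i a) (Poly_Mapping.single j b)
      (Poly_Mapping.single k c) = 0" for i j k a b c
    by (simp add: J_def witt_bracket_single add_ac single_add[symmetric])
      (simp add: algebra_simps)
  have 1: "J (Poly_Mapping.single i a) (Poly_Mapping.single j b) z = 0" for i j a b z
    by (induction z rule: witt_induct) (simp_all add: J_add J_zero J_single)
  have 2: "J (Poly_Mapping.single i a) y z = 0" for i a y z
    by (induction y rule: witt_induct) (simp_all add: J_add J_zero 1)
  have "J x y z = 0"
    by (induction x rule: witt_induct) (simp_all add: J_add J_zero 2)
  then show ?thesis by (simp add: J_def)
qed

lemma witt_pos_lie_algebra: "complex_lie_algebra witt_scale witt_pos witt_bracket"
proof -
  interpret vector_space witt_scale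
    by unfold_locales
      (simp_all add: poly_mapping_eq_iff fun_eq_iff lookup_witt_scale lookup_add algebra_simps)
  show ?thesis
  proof unfold_locales
    show "subspace witt_pos"
      by (auto simp: subspace_def witt_pos_def subset_iff in_keys_iff lookup_add lookup_witt_scale)
        (metis add_0)
  next
    fix x y :: "int \<Rightarrow>\<^sub>0 complex" assume *: "x \<in> witt_pos" "y \<in> witt_pos"
    show "witt_bracket x y \<in> witt_pos"
    proof -
      have "Poly_Mapping.lookup (witt_bracket x y) k = 0" if "k < - 1" for k
      proof -
        have "of_int (i - j) * Poly_Mapping.lookup x i * Poly_Mapping.lookup y j = 0"
          if "i \<in> Poly_Mapping.keys x" "j \<in> Poly_Mapping.keys y" "i + j = k" for i j
        proof -
          have "i \<ge> - 1" "j \<ge> - 1" using * that by (auto simp: witt_pos_def)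
          with that(3) \<open>k < - 1\<close> have "i = - 1" "j = - 1" by auto
          then show ?thesis by simp
        qed
        then show ?thesis
          unfolding witt_bracket_def lookup_sum lookup_single
          by (intro sum.neutral ballI) (auto simp: when_def)
      qed
      then show ?thesis by (auto simp: witt_pos_def in_keys_iff simp flip: not_less)
    qed
  next
    fix x :: "int \<Rightarrow>\<^sub>0 complex"
    have "witt_bracket x x = - witt_bracket x x" by (rule witt_bracket_swap)
    then have "Poly_Mapping.lookup (witt_bracket x x) k = - Poly_Mapping.lookup (witt_bracket x x) k"
      for k by (metis lookup_uminus)
    then show "witt_bracket x x = 0" by (intro poly_mapping_eqI) simp
  next
    fix x y a
    have "witt_bracket x (witt_scale a y) = - witt_scale a (witt_bracket y x)"
      using witt_bracket_swap[of x "witt_scale a y"] by (simp add: witt_bracket_scale_left)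
    also have "\<dots> = witt_scale a (witt_bracket x y)"
      using witt_bracket_swap[of y x] by (simp add: poly_mapping_eq_iff fun_eq_iff lookup_witt_scale)
    finally show "witt_bracket x (witt_scale a y) = witt_scale a (witt_bracket x y)" .
  qed (simp_all add: witt_bracket_add_left witt_bracket_add_right witt_bracket_scale_left witt_jacobi)
qed


context
  fixes scaleM :: "complex \<Rightarrow> 'm::ab_group_add \<Rightarrow> 'm"
    and \<sigma> :: "complex^2^2 \<Rightarrow> 'm \<Rightarrow> 'm"
begin

definition casimir :: "'m \<Rightarrow> 'm" where
  "casimir = (\<lambda>m. ((\<lambda>v. \<sigma> sl2_h v + v) ^^ 2) m + scaleM 4 (\<sigma> sl2_f (\<sigma> sl2_e m)))"

definition weight_space :: "complex \<Rightarrow> 'm set" where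
  "weight_space \<mu> = {m. \<sigma> sl2_h m = scaleM \<mu> m}"

definition weight_supp :: "complex set" where
  "weight_supp = {\<mu>. weight_space \<mu> \<noteq> {0}}"

text \<open>Internal direct sum: every vector is in a unique way a finite sum of weight vectors.\<close>

definition weight_module :: bool where
  "weight_module \<longleftrightarrow> (\<forall>m. \<exists>!w. (\<forall>\<mu>. w \<mu> \<in> weight_space \<mu>) \<and> finite {\<mu>. w \<mu> \<noteq> 0}
     \<and> m = (\<Sum>\<mu> | w \<mu> \<noteq> 0. w \<mu>))"

definition Mbar_object :: "complex set \<Rightarrow> complex \<Rightarrow> bool" where
  "Mbar_object \<xi> \<tau> \<longleftrightarrow>
     lie_representation mat_scale sl2 mat_bracket scaleM \<sigma>
     \<and> weight_module
     \<and> (\<forall>\<mu>. \<exists>B. finite B \<and> module.span scaleM B = weight_space \<mu>)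
     \<and> weight_supp \<subseteq> \<xi>
     \<and> (\<forall>\<mu>\<in>\<xi>. \<exists>n. \<forall>m\<in>weight_space \<mu>. ((\<lambda>v. casimir v - scaleM \<tau> v) ^^ n) m = 0)"

end

text \<open>The quotient \<open>UNIV // cong_2Z\<close> is $\mathbb{C}/2\mathbb{Z}$; its elements are subsets
  of the complex numbers.\<close>

definition cong_2Z :: "(complex \<times> complex) set" where
  "cong_2Z = {(x, y). \<exists>k::int. x - y = 2 * of_int k}"

end

theory Submission
  imports Defs "HOL-Library.Function_Algebras" "HOL-Computational_Algebra.Polynomial"
begin

text \<open>
  A representation of the positive Witt algebra that extends \<open>\<sigma>\<close> and sends \<open>L\<^sub>2\<close> to \<open>T\<close> must send \<open>L\<^sub>k\<close>
  to \<open>ad(e)\<^sup>k\<^sup>-\<^sup>2 T / (k - 2)!\<close> for \<open>k \<ge> 2\<close>. It remains to see that these operators satisfy the Witt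
  relations. The Jacobi identity reduces all of them to the \<open>sl(2)\<close>-relations, the relations of \<open>T\<close>
  with \<open>f\<close> and \<open>h\<close>, and two more: \<open>[L\<^sub>2, L\<^sub>3] = - L\<^sub>5\<close> and \<open>[L\<^sub>2, L\<^sub>5] = -3 L\<^sub>7\<close>
  (\<open>witt_relations_from_degrees_5_and_7\<close>). The first of these is the assumption on
  \<open>[T, ad(e) T]\<close>; the second one has to be derived.

  The condition \<open>\<tau> \<noteq> (\<mu> + 1)\<^sup>2\<close> makes \<open>f\<close> surjective (\<open>lowering_operator_surj\<close>), so an operator \<open>A\<close> is
  determined by \<open>A f\<^sup>k\<close>. With \<open>D = - h / 2\<close>, the assumptions on \<open>T\<close> imply that
  \<open>- e f = D\<^sup>2 + D + C\<close> and \<open>T f\<^sup>2 = D (D + 1) (D + 2) + 3 C D + B\<close> with operators \<open>B\<close> and \<open>C\<close> that commute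
  with each other, with \<open>D\<close> and with \<open>f\<close>. Moving \<open>f\<close> past \<open>D\<close> shifts \<open>D\<close> by \<open>1\<close>, hence each \<open>L\<^sub>k f\<^sup>k\<close> is
  an explicit polynomial in \<open>B\<close>, \<open>C\<close>, \<open>D\<close>, called the symbol of \<open>L\<^sub>k\<close>. In terms of symbols, the
  relation in degree 5 becomes the single equation \<open>B\<^sup>2 - 6 B C + 8 C\<^sup>2 + 4 C\<^sup>3 = 0\<close>
  (\<open>witt_symbol_degree5\<close>), and the relation in degree 7 is a multiple of it
  (\<open>witt_symbol_degree7\<close>).
\<close>

section \<open>A presentation of the positive Witt algebra\<close>

context complex_lie_algebra
begin

lemma bracket_minus:
  assumes "x \<in> \<g>" "y \<in> \<g>"
  shows "bracket x (- y) = - bracket x y" "bracket (- x) y = - bracket x y"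
  using bracket_scale_right[OF assms, of "-1"] bracket_scale_left[OF assms, of "-1"] by simp_all

lemma bracket_anticommute:
  assumes "x \<in> \<g>" "y \<in> \<g>"
  shows "bracket y x = - bracket x y"
proof -
  have "x + y \<in> \<g>" using assms by (simp add: subspace_add[OF subspace_carrier])
  then have "0 = bracket (x + y) (x + y)" by (simp add: bracket_self)
  also have "\<dots> = bracket x y + bracket y x"
    using assms bracket_add_left[of x y "x + y"] bracket_add_right[of x x y]
      bracket_add_right[of y x y]
    by (simp add: bracket_self \<open>x + y \<in> \<g>\<close>)
  finally show ?thesis by (simp add: eq_neg_iff_add_eq_0 add.commute)
qed

lemma bracket_leibniz:
  assumes "x \<in> \<g>" "y \<in> \<g>" "z \<in> \<g>"
  shows "bracket x (bracket y z) = bracket (bracket x y) z + bracket y (bracket x z)"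
proof -
  have "bracket z (bracket x y) = - bracket (bracket x y) z"
    using assms bracket_anticommute[of "bracket x y" z] by (simp add: bracket_closed)
  moreover have "bracket y (bracket z x) = - bracket y (bracket x z)"
    using assms bracket_anticommute[of x z] by (simp add: bracket_minus bracket_closed)
  ultimately show ?thesis using jacobi[OF assms] by (simp add: algebra_simps)
qed

text \<open>
  The amount by which a family \<open>L\<close> misses the Witt relation for the pair \<open>(i, j)\<close>. Working with
  this difference turns the Jacobi identity into a linear relation between a few defects, because
  the structure constants of the Witt algebra satisfy the Jacobi identity themselves.
\<close>

definition witt_defect :: "(int \<Rightarrow> 'g) \<Rightarrow> int \<Rightarrow> int \<Rightarrow> 'g" where
  "witt_defect L i j = bracket (L i) (L j) - scale (of_int (i - j)) (L (i + j))"

lemma witt_defect_swap: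
  assumes "\<And>k. L k \<in> \<g>"
  shows "witt_defect L j i = - witt_defect L i j"
proof -
  have "scale (of_int (j - i)) (L (j + i)) = - scale (of_int (i - j)) (L (i + j))"
    by (simp add: add.commute flip: scale_minus_left)
  then show ?thesis using bracket_anticommute[of "L i" "L j"] assms by (simp add: witt_defect_def)
qed

text \<open>
  Apply \<open>ad (L x)\<close> to the Witt relation for \<open>(i, j)\<close>. Once the three relations among \<open>x\<close>, \<open>i\<close> and
  \<open>j\<close> hold, only the defects in degree \<open>x + i + j\<close> survive.
\<close>

lemma witt_defect_leibniz:
  assumes L: "\<And>k. L k \<in> \<g>"
    and "witt_defect L x i = 0" "witt_defect L x j = 0" "witt_defect L i j = 0"
  shows "scale (of_int (x - i)) (witt_defect L (x + i) j)
       + scale (of_int (x - j)) (witt_defect L i (x + j))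
       = scale (of_int (i - j)) (witt_defect L x (i + j))"
proof -
  have br: "bracket (L x) (L i) = scale (of_int (x - i)) (L (x + i))"
    "bracket (L x) (L j) = scale (of_int (x - j)) (L (x + j))"
    "bracket (L i) (L j) = scale (of_int (i - j)) (L (i + j))"
    using assms(2-4) by (simp_all add: witt_defect_def)
  have "scale (of_int (i - j)) (bracket (L x) (L (i + j)))
     = scale (of_int (x - i)) (bracket (L (x + i)) (L j))
     + scale (of_int (x - j)) (bracket (L i) (L (x + j)))"
    using bracket_leibniz[of "L x" "L i" "L j"] L
    by (simp add: br bracket_scale_left bracket_scale_right del: of_int_diff)
  moreover have "scale (of_int ((i - j) * (x - (i + j)))) (L (x + i + j))
     = scale (of_int ((x - i) * (x + i - j))) (L (x + i + j))
     + scale (of_int ((x - j) * (i - (x + j)))) (L (x + i + j))"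
    by (simp only: scale_left_distrib[symmetric] of_int_add[symmetric]) (simp add: algebra_simps)
  ultimately show ?thesis
    unfolding witt_defect_def
    by (simp add: scale_right_diff_distrib add_ac del: of_int_diff of_int_add flip: of_int_mult)
qed

lemma scale_of_int_eq_zero: "scale (of_int k) x = 0 \<Longrightarrow> k \<noteq> 0 \<Longrightarrow> x = 0"
  by simp

text \<open>
  The presentation of the positive Witt algebra: besides the \<open>sl(2)\<close>-relations and the ladder
  \<open>[L\<^sub>1, L\<^sub>k] = (1 - k) L\<^sub>k\<^sub>+\<^sub>1\<close>, which serves to construct \<open>L\<^sub>3, L\<^sub>4, \<dots>\<close> from \<open>L\<^sub>2\<close>, only one relation in
  degree 5 and one in degree 7 are required. In degree \<open>n\<close>, the Leibniz rule with \<open>x = 1\<close> ties all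
  the defects of the pairs \<open>(i, n - i)\<close> to that of \<open>(2, n - 2)\<close>. Antisymmetry makes this one vanish
  for \<open>n = 4\<close> and \<open>n = 6\<close>, and for \<open>n \<ge> 8\<close> the Leibniz rule with \<open>x = 2\<close> gives a second,
  independent linear relation.
\<close>

theorem witt_relations_from_degrees_5_and_7:
  assumes L: "\<And>k. L k \<in> \<g>"
    and sl2: "witt_defect L (-1) 0 = 0" "witt_defect L (-1) 1 = 0" "witt_defect L 0 1 = 0"
    and L2: "witt_defect L (-1) 2 = 0" "witt_defect L 0 2 = 0"
    and ladder: "\<And>k. k \<ge> 2 \<Longrightarrow> witt_defect L 1 k = 0"
    and deg5: "witt_defect L 2 3 = 0"
    and deg7: "witt_defect L 2 5 = 0"
    and ij: "i \<ge> -1" "j \<ge> -1"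
  shows "witt_defect L i j = 0"
proof -
  let ?R = "witt_defect L"
  have swap: "?R j i = 0 \<longleftrightarrow> ?R i j = 0" for i j
    using witt_defect_swap[of L j i, OF L] by simp
  have self: "?R i i = 0" for i
    by (simp add: witt_defect_def bracket_self L)
  note leibniz = witt_defect_leibniz[of L, OF L]
  have ladder: "?R 1 k = 0" if "k \<ge> 1" for k
    using ladder[of k] self[of 1] that by (cases "k = 1") auto
  have R0: "?R 0 k = 0" if "k \<ge> 2" for k
    using that
  proof (induction k rule: int_ge_induct)
    case base
    then show ?case by (rule L2)
  next
    case (step k)
    then show ?case
      using leibniz[of 0 1 k] sl2(3) ladder[of k] scale_of_int_eq_zero[of "1 - k" "?R 0 (k + 1)"]
      by (simp add: add.commute)
  qed
  have Rm1: "?R (-1) k = 0" if "k \<ge> 2" for k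
    using that
  proof (induction k rule: int_ge_induct)
    case base
    then show ?case by (rule L2)
  next
    case (step k)
    then show ?case
      using leibniz[of "-1" 1 k] sl2(2) ladder[of k] ladder[of "k - 1"] R0[of k]
        scale_of_int_eq_zero[of "1 - k" "?R (-1) (k + 1)"]
      by (simp add: add.commute)
  qed
  have small: "?R i k = 0" if "i \<in> {-1, 0}" "k \<ge> -1" for i k
  proof -
    have "k = -1 \<or> k = 0 \<or> k = 1 \<or> k \<ge> 2" using that by auto
    then show ?thesis
      using that sl2 R0 Rm1 self swap[of "-1" 0] by auto
  qed
  have pos: "?R i (n - i) = 0" if "1 \<le> i" "i < n" for i n
    using that
  proof (induction "nat n" arbitrary: i n rule: less_induct)
    case less
    have IH: "?R i j = 0" if "1 \<le> i" "1 \<le> j" "i + j < n" for i j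
      using less.hyps[of "i + j" i] that less.prems by simp
    define r where "r i = ?R i (n - i)" for i
    have chain: "scale (of_int (i - 1)) (r (i + 1)) = scale (of_int (2 + i - n)) (r i)"
      if "1 \<le> i" "i < n - 1" for i
      using leibniz[of 1 i "n - 1 - i"] that IH[of 1 i] IH[of 1 "n - 1 - i"] IH[of i "n - 1 - i"]
        ladder[of "n - 1"]
      by (simp add: r_def algebra_simps)
    have r1: "r 1 = 0"
      using ladder[of "n - 1"] less.prems by (simp add: r_def)
    have r2: "r 2 = 0" if n4: "n \<ge> 4"
    proof -
      have "n = 4 \<or> n = 5 \<or> n = 6 \<or> n = 7 \<or> n \<ge> 8" using n4 by linarith
      then consider "n = 4" | "n = 5" | "n = 6" | "n = 7" | "n \<ge> 8" by blast
      then show ?thesis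
      proof cases
        case 3
        then show ?thesis using chain[of 2] self[of 3] by (simp add: r_def)
      next
        case 5
        \<comment> \<open>The chain expresses \<open>r 3\<close>, \<open>r 4\<close> and \<open>r 5\<close> through \<open>r 2\<close>; substituting them into the
          Leibniz rule for \<open>(2, 3, n - 5)\<close> leaves a multiple of \<open>r 2\<close> whose factor is nonzero.\<close>
        have r3: "r 3 = scale (of_int (4 - n)) (r 2)"
          using chain[of 2] 5 by simp
        have r4: "scale 2 (r 4) = scale (of_int ((5 - n) * (4 - n))) (r 2)"
          using chain[of 3] 5 by (simp add: r3)
        have "scale 6 (r 5) = scale 2 (scale 3 (r 5))"
          by simp
        also have "scale 3 (r 5) = scale (of_int (6 - n)) (r 4)"
          using chain[of 4] 5 by simp
        also have "scale 2 (scale (of_int (6 - n)) (r 4)) = scale (of_int (6 - n)) (scale 2 (r 4))"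
          by (rule scale_left_commute)
        finally have "scale 6 (r 5) = scale (of_int (6 - n)) (scale 2 (r 4))" .
        then have r5: "scale 6 (r 5) = scale (of_int ((6 - n) * (5 - n) * (4 - n))) (r 2)"
          by (simp add: r4 mult.assoc)
        have "- r 5 + scale (of_int (7 - n)) (r 3) = scale (of_int (8 - n)) (r 2)"
          using leibniz[of 2 3 "n - 5"] 5 IH[of 2 3] IH[of 2 "n - 5"] IH[of 3 "n - 5"]
          by (simp add: r_def)
        then have "scale 6 (- r 5 + scale (of_int (7 - n)) (r 3)) = scale 6 (scale (of_int (8 - n)) (r 2))"
          by simp
        then have "- scale 6 (r 5) + scale (of_int (6 * (7 - n) * (4 - n))) (r 2)
            = scale (of_int (6 * (8 - n))) (r 2)"
          by (simp only: scale_right_distrib scale_minus_right r3 scale_scale of_int_mult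
              of_int_numeral mult.assoc)
        then have "scale (of_int (- ((6 - n) * (5 - n) * (4 - n)) + 6 * (7 - n) * (4 - n)
            - 6 * (8 - n))) (r 2) = 0"
          by (simp only: r5 of_int_add[of "_ + _"] of_int_add of_int_diff[of "_ + _"] of_int_minus
              scale_left_distrib scale_left_diff_distrib scale_minus_left diff_self)
        moreover have "- ((6 - n) * (5 - n) * (4 - n)) + 6 * (7 - n) * (4 - n) - 6 * (8 - n) \<noteq> 0"
        proof -
          have "0 < (n - 4) * (n - 5) * (n - 6)" using 5 by simp
          moreover have "0 \<le> (n - 7) * (n - 4)" using 5 by simp
          ultimately show ?thesis using 5 by (simp add: algebra_simps)
        qed
        ultimately show ?thesis by (rule scale_of_int_eq_zero)
      qed (use self[of 2] deg5 deg7 in \<open>simp_all add: r_def\<close>)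
    qed
    have "r i = 0" if "1 \<le> i" "i < n" for i
      using that
    proof (induction i rule: int_ge_induct)
      case base
      show ?case by (rule r1)
    next
      case (step i)
      show ?case
      proof (cases "i = 1")
        case True
        show ?thesis
        proof (cases "n = 3")
          case True
          with \<open>i = 1\<close> show ?thesis using ladder[of 2] swap[of 1 2] by (simp add: r_def)
        qed (use r2 step True in simp)
      next
        case False
        then show ?thesis
          using chain[of i] step scale_of_int_eq_zero[of "i - 1" "r (i + 1)"] by simp
      qed
    qed
    then show ?case using less.prems by (simp add: r_def)
  qed
  show ?thesis
    using small[of i j] small[of j i] pos[of i "i + j"] ij swap[of i j] by fastforce
qed

end

section \<open>Polynomials in commuting operators\<close>

text \<open>
  The classical construction that turns a module with an endomorphism \<open>X\<close> into a module over the
  polynomial ring, the indeterminate acting as \<open>X\<close>. Iterating it yields the action of a polynomial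
  ring in several commuting operators, and so allows identities between commuting operators to be
  proved in a commutative ring.
\<close>

definition poly_act ::
    "('a::comm_ring_1 \<Rightarrow> 'm \<Rightarrow> 'm) \<Rightarrow> ('m \<Rightarrow> 'm) \<Rightarrow> 'a poly \<Rightarrow> 'm \<Rightarrow> 'm::ab_group_add" where
  "poly_act s X p = fold_coeffs (\<lambda>a A m. s a m + X (A m)) p (\<lambda>m. 0)"

context
  fixes s :: "'a::comm_ring_1 \<Rightarrow> 'm \<Rightarrow> 'm::ab_group_add" and X :: "'m \<Rightarrow> 'm"
  assumes hom: "module_hom s s X"
begin

lemma poly_act_0: "poly_act s X 0 m = 0"
  by (simp add: poly_act_def)

lemma poly_act_pCons: "poly_act s X (pCons a p) m = s a m + X (poly_act s X p m)"
proof (cases "a = 0 \<and> p = 0")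
  case True
  interpret module_hom s s X by (rule hom)
  show ?thesis using True by (simp add: poly_act_0 zero m1.scale_zero_left)
next
  case False
  then have "fold_coeffs (\<lambda>a A m. s a m + X (A m)) (pCons a p) =
    (\<lambda>A m. s a m + X (A m)) \<circ> fold_coeffs (\<lambda>a A m. s a m + X (A m)) p"
    using fold_coeffs_pCons_coeff_not_0_eq[of a] fold_coeffs_pCons_not_0_0_eq[of p] by blast
  then show ?thesis by (simp add: poly_act_def)
qed

lemma poly_act_const: "poly_act s X [:a:] m = s a m"
proof -
  interpret module_hom s s X by (rule hom)
  show ?thesis by (simp add: poly_act_0 poly_act_pCons zero)
qed

lemma poly_act_X: "poly_act s X [:0, 1:] m = X m"
proof -
  interpret module_hom s s X by (rule hom)
  show ?thesis by (simp add: poly_act_0 poly_act_pCons zero m1.scale_zero_left m1.scale_one)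
qed

lemma module_poly_act: "module (poly_act s X)"
proof -
  interpret module_hom s s X by (rule hom)
  note simps = poly_act_0 poly_act_pCons m1.scale_right_distrib m1.scale_left_distrib add scale
  have "poly_act s X p (x + y) = poly_act s X p x + poly_act s X p y" for p x y
    by (induction p) (simp_all only: simps add_0_left add_0_right ac_simps)
  moreover have add_poly: "poly_act s X (p + q) x = poly_act s X p x + poly_act s X q x" for p q x
    by (induction p q rule: poly_induct2) (simp_all only: simps add_pCons add_0_left ac_simps)
  moreover have smult: "poly_act s X (smult a p) x = s a (poly_act s X p x)" for a p x
    by (induction p) (simp_all only: simps smult_0_right smult_pCons m1.scale_scale m1.scale_zero_right)
  moreover have "poly_act s X p (poly_act s X q x) = poly_act s X (p * q) x" for p q x
    by (induction p)
      (simp_all only: simps mult_pCons_left mult_zero_left add_poly smult m1.scale_zero_left add_0_left)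
  moreover have "poly_act s X 1 x = x" for x
    by (simp only: one_pCons poly_act_const m1.scale_one)
  ultimately show ?thesis by unfold_locales
qed

lemma module_hom_poly_act:
  assumes Y: "module_hom s s Y" and comm: "\<And>m. Y (X m) = X (Y m)"
  shows "module_hom (poly_act s X) (poly_act s X) Y"
proof -
  note Y' = module_hom.add[OF Y] module_hom.scale[OF Y] module_hom.zero[OF Y]
  have "Y (poly_act s X p m) = poly_act s X p (Y m)" for p m
    by (induction p) (simp_all only: poly_act_0 poly_act_pCons Y' comm)
  then show ?thesis
    using module_hom.add[OF Y] by (simp add: module_hom_iff module_poly_act)
qed

text \<open>
  If moving \<open>X\<close> past \<open>Y\<close> replaces \<open>X\<close> by \<open>r(X)\<close>, then moving \<open>p(X)\<close> past \<open>Y\<close> replaces it by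
  \<open>p(r(X))\<close>. The case of interest is \<open>r(X) = X + 1\<close>, a weight shift.
\<close>

lemma poly_act_semilinear:
  assumes Y: "module_hom s s Y" and XY: "\<And>m. X (Y m) = Y (poly_act s X r m)"
  shows "poly_act s X p (Y m) = Y (poly_act s X (pcompose p r) m)"
proof (induction p)
  case 0
  show ?case by (simp only: poly_act_0 pcompose_0 module_hom.zero[OF Y])
next
  case (pCons a p)
  have "poly_act s X (pCons a p) (Y m)
      = s a (Y m) + X (Y (poly_act s X (pcompose p r) m))"
    by (simp only: poly_act_pCons pCons)
  also have "\<dots> = Y (poly_act s X [:a:] m + poly_act s X r (poly_act s X (pcompose p r) m))"
    by (simp only: module_hom.add[OF Y] module_hom.scale[OF Y] XY poly_act_const)
  also have "\<dots> = Y (poly_act s X (pcompose (pCons a p) r) m)"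
    by (simp only: pcompose_pCons module.scale_left_distrib[OF module_poly_act]
        module.scale_scale[OF module_poly_act])
  finally show ?case .
qed

end

section \<open>Symbols of the Witt generators\<close>

text \<open>
  The polynomial \<open>k! L\<^sub>k\<^sub>+\<^sub>2 L\<^sub>-\<^sub>1\<^sup>k\<^sup>+\<^sup>2\<close> in \<open>d = L\<^sub>0\<close>. Here \<open>L\<^sub>1 L\<^sub>-\<^sub>1 = d\<^sup>2 + d + c\<close> defines the Casimir parameter
  \<open>c\<close>, and \<open>b\<close> is the one remaining freedom in the choice of \<open>L\<^sub>2\<close>: the relation
  \<open>[L\<^sub>-\<^sub>1, L\<^sub>2] = -3 L\<^sub>1\<close> fixes the differences of the cubic polynomial below. The recursion is the
  bracket with \<open>L\<^sub>1\<close>; moving \<open>L\<^sub>-\<^sub>1\<close> past \<open>d\<close> shifts \<open>d\<close> by \<open>1\<close>.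
\<close>

primrec witt_symbol :: "'a::idom \<Rightarrow> 'a \<Rightarrow> nat \<Rightarrow> 'a \<Rightarrow> 'a" where
  "witt_symbol c b 0 d = d ^ 3 + 3 * d ^ 2 + (2 + 3 * c) * d + b"
| "witt_symbol c b (Suc k) d =
     witt_symbol c b k d * ((d + of_nat (k + 2)) ^ 2 + (d + of_nat (k + 2)) + c)
     - (d ^ 2 + d + c) * witt_symbol c b k (d + 1)"

lemma witt_symbol_numeral:
  "witt_symbol c b 1 d = witt_symbol c b 0 d * ((d + 2) ^ 2 + (d + 2) + c)
     - (d ^ 2 + d + c) * witt_symbol c b 0 (d + 1)"
  "witt_symbol c b 2 d = witt_symbol c b 1 d * ((d + 3) ^ 2 + (d + 3) + c)
     - (d ^ 2 + d + c) * witt_symbol c b 1 (d + 1)"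
  "witt_symbol c b 3 d = witt_symbol c b 2 d * ((d + 4) ^ 2 + (d + 4) + c)
     - (d ^ 2 + d + c) * witt_symbol c b 2 (d + 1)"
  "witt_symbol c b 4 d = witt_symbol c b 3 d * ((d + 5) ^ 2 + (d + 5) + c)
     - (d ^ 2 + d + c) * witt_symbol c b 3 (d + 1)"
  "witt_symbol c b 5 d = witt_symbol c b 4 d * ((d + 6) ^ 2 + (d + 6) + c)
     - (d ^ 2 + d + c) * witt_symbol c b 4 (d + 1)"
  by (simp_all add: eval_nat_numeral)

text \<open>
  The relation \<open>[L\<^sub>2, L\<^sub>3] = - L\<^sub>5\<close>, multiplied by \<open>6\<close> to clear the factorials, on the level of
  symbols: no \<open>d\<close> survives, so it is a single equation between \<open>b\<close> and \<open>c\<close>.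
\<close>

lemma witt_symbol_degree5:
  "6 * (witt_symbol c b 0 d * witt_symbol c b 1 (d + 2)
      - witt_symbol c b 1 d * witt_symbol c b 0 (d + 3)) + witt_symbol c b 3 d
   = 48 * (b ^ 2 - 6 * b * c + 8 * c ^ 2 + 4 * c ^ 3)"
  unfolding witt_symbol_numeral witt_symbol.simps(1) by algebra

text \<open>
  The relation \<open>[L\<^sub>2, L\<^sub>5] = -3 L\<^sub>7\<close>, multiplied by \<open>120\<close>, is a multiple of the same polynomial. This
  can be foreseen: the curve cut out by that polynomial is irreducible and is parametrised by the
  modules of densities, with \<open>c = \<gamma> (1 - \<gamma>)\<close> and \<open>b = 2 \<gamma> (1 - \<gamma>) (1 + \<gamma>)\<close>, where all Witt
  relations hold.
\<close>

lemma witt_symbol_degree7: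
  "20 * (witt_symbol c b 0 d * witt_symbol c b 3 (d + 2)
       - witt_symbol c b 3 d * witt_symbol c b 0 (d + 5)) + 3 * witt_symbol c b 5 d
   = (14400 * d ^ 2 + 100800 * d + 174240 - 2880 * c)
     * (b ^ 2 - 6 * b * c + 8 * c ^ 2 + 4 * c ^ 3)"
  unfolding witt_symbol_numeral witt_symbol.simps(1) by algebra

lemma pcompose_power: "pcompose (p ^ n) r = pcompose p r ^ n"
  by (induction n) (simp_all add: pcompose_1 pcompose_mult)

lemma pcompose_of_nat: "pcompose (of_nat n) r = of_nat n"
  by (simp add: of_nat_poly)

lemma pcompose_numeral: "pcompose (numeral n) r = numeral n"
  using pcompose_of_nat[of "numeral n" r] by simp

lemma pcompose_witt_symbol:
  "pcompose (witt_symbol [:c:] [:b:] k d) r = witt_symbol [:c:] [:b:] k (pcompose d r)"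
proof (induction k arbitrary: d)
  case 0
  show ?case
    by (simp only: witt_symbol.simps pcompose_add pcompose_mult pcompose_power pcompose_numeral
        pcompose_const)
next
  case (Suc k)
  show ?case
    by (simp only: witt_symbol.simps Suc pcompose_diff pcompose_add pcompose_mult pcompose_power
        pcompose_of_nat pcompose_1 pcompose_const)
qed

text \<open>
  The operators \<open>B\<close>, \<open>C\<close>, \<open>D\<close> commute with one another, and \<open>F\<close> commutes with \<open>B\<close> and \<open>C\<close> while it
  shifts \<open>D\<close> by \<open>1\<close>. As \<open>F\<close> is onto, an operator is determined by its composite with a power of
  \<open>F\<close>; this composite is recorded as a polynomial.
\<close>

locale symbol_calculus = vector_space scale
  for scale :: "complex \<Rightarrow> 'm::ab_group_add \<Rightarrow> 'm" +
  fixes C B D F :: "'m \<Rightarrow> 'm"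
  assumes C: "module_hom scale scale C" and B: "module_hom scale scale B"
    and D: "module_hom scale scale D" and F: "module_hom scale scale F"
    and BC: "B (C m) = C (B m)" and DC: "D (C m) = C (D m)" and DB: "D (B m) = B (D m)"
    and FC: "F (C m) = C (F m)" and FB: "F (B m) = B (F m)"
    and DF: "D (F m) = F (D m) + F m"
    and F_surj: "surj F"
begin

definition c :: "complex poly poly poly" where "c = [:[:[:0, 1:]:]:]"
definition b :: "complex poly poly poly" where "b = [:[:0, 1:]:]"
definition d :: "complex poly poly poly" where "d = [:0, 1:]"

text \<open>
  The variable for \<open>D\<close> is the outermost one, so that the weight shift is the substitution of
  \<open>d + 1\<close> for the indeterminate of a univariate polynomial.
\<close>

definition act :: "complex poly poly poly \<Rightarrow> 'm \<Rightarrow> 'm" where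
  "act = poly_act (poly_act (poly_act scale C) B) D"

lemmas B1 = module_hom_poly_act[OF C B BC]
lemmas D1 = module_hom_poly_act[OF C D DC]
lemmas F1 = module_hom_poly_act[OF C F FC]
lemmas D2 = module_hom_poly_act[OF B1 D1 DB]
lemmas F2 = module_hom_poly_act[OF B1 F1 FB]

sublocale act: module act
  unfolding act_def by (rule module_poly_act[OF D2])

lemma act_c: "act c m = C m" and act_b: "act b m = B m" and act_d: "act d m = D m"
  by (simp_all add: act_def c_def b_def d_def poly_act_const[OF B1] poly_act_const[OF D2]
      poly_act_X[OF C] poly_act_X[OF B1] poly_act_X[OF D2])

lemma act_of_nat: "act (of_nat n) m = scale (of_nat n) m"
  by (induction n) (simp_all add: act.scale_left_distrib scale_left_distrib)

lemma act_numeral_mult: "act (numeral n * p) m = scale (numeral n) (act p m)"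
  using act_of_nat[of "numeral n"] by (simp flip: act.scale_scale)

lemma act_numeral: "act (numeral n) m = scale (numeral n) m"
  using act_numeral_mult[of n 1 m] by simp

lemma act_shift: "act p ((F ^^ k) m) = (F ^^ k) (act (pcompose p (d + of_nat k)) m)"
proof -
  have F: "act p (F m) = F (act (pcompose p (d + 1)) m)" for p m
    unfolding act_def
  proof (rule poly_act_semilinear[OF D2 F2])
    fix m
    have "D (F m) = F (act d m + act 1 m)"
      using F by (simp add: act_d DF module_hom.add)
    then show "D (F m) = F (poly_act (poly_act (poly_act scale C) B) D (d + 1) m)"
      by (simp only: flip: act.scale_left_distrib act_def)
  qed
  have comp: "pcompose (d + x) r = r + pcompose x r" for x r
    by (simp add: d_def pcompose_add pcompose_pCons)
  show ?thesis
  proof (induction k arbitrary: p)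
    case 0
    then show ?case by (simp add: d_def)
  next
    case (Suc k)
    have "pcompose (d + 1) (d + of_nat k) = d + of_nat (Suc k)"
      by (simp only: comp pcompose_1 of_nat_Suc add.assoc add.commute[of 1])
    then have "pcompose (pcompose p (d + 1)) (d + of_nat k) = pcompose p (d + of_nat (Suc k))"
      by (simp only: pcompose_assoc[symmetric])
    then show ?case by (simp add: F Suc)
  qed
qed

definition has_symbol :: "nat \<Rightarrow> ('m \<Rightarrow> 'm) \<Rightarrow> complex poly poly poly \<Rightarrow> bool" where
  "has_symbol k A p \<longleftrightarrow> (\<forall>m. A ((F ^^ k) m) = act p m)"

text \<open>
  Symbols multiply up to a shift, since the power of \<open>F\<close> that belongs to the left factor has to be
  moved past the symbol of the right one.
\<close>

lemma has_symbol_comp: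
  assumes "has_symbol i A p" "has_symbol j A' q"
  shows "has_symbol (i + j) (\<lambda>m. A (A' m)) (p * pcompose q (d + of_nat i))"
  using assms by (simp add: has_symbol_def add.commute[of i] funpow_add act_shift)

lemma has_symbol_ad:
  assumes "has_symbol i A p" "has_symbol j A' q"
  shows "has_symbol (i + j) (ad A A') (p * pcompose q (d + of_nat i) - q * pcompose p (d + of_nat j))"
  using has_symbol_comp[OF assms] has_symbol_comp[OF assms(2,1)]
  by (simp add: has_symbol_def ad_def add.commute[of j] act.scale_left_diff_distrib)

lemma has_symbol_ad_power:
  assumes E: "has_symbol 1 E (- (d ^ 2 + d + c))"
    and T: "has_symbol 2 T (witt_symbol c b 0 d)"
  shows "has_symbol (k + 2) ((ad E ^^ k) T) (witt_symbol c b k d)"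
proof (induction k)
  case 0
  show ?case using T by (simp only: funpow_0 add_0)
next
  case (Suc k)
  have d: "pcompose d r = r" for r by (simp add: d_def pcompose_pCons)
  have c: "pcompose c r = c" for r by (simp add: c_def)
  have w: "pcompose (witt_symbol c b k d) r = witt_symbol c b k r" for r
    using pcompose_witt_symbol[of "[:[:0, 1:]:]" "[:0, 1:]" k d r] by (simp add: c_def b_def d)
  have "has_symbol (1 + (k + 2)) (ad E ((ad E ^^ k) T))
      (- (d ^ 2 + d + c) * witt_symbol c b k (d + of_nat 1)
       - witt_symbol c b k d * - ((d + of_nat (k + 2)) ^ 2 + (d + of_nat (k + 2)) + c))"
    using has_symbol_ad[OF E Suc]
    by (simp only: pcompose_uminus pcompose_add pcompose_power d c w)
  then show ?case
    by (simp add: algebra_simps)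
qed

text \<open>
  By the two identities for symbols, the relation in degree 5 says that a polynomial \<open>q(b, c)\<close> acts
  as zero, whereas the relation in degree 7 holds after composition with \<open>F\<^sup>7\<close> because its symbol is
  a multiple of \<open>q\<close>. Surjectivity of \<open>F\<close> removes the power.
\<close>

lemma degree7_from_degree5:
  assumes E: "has_symbol 1 E (- (d ^ 2 + d + c))"
    and T: "has_symbol 2 T (witt_symbol c b 0 d)"
    and deg5: "ad T (ad E T) = (\<lambda>m. scale (- (1/6)) ((ad E ^^ 3) T m))"
  shows "ad T ((ad E ^^ 3) T) = (\<lambda>m. scale (- (3/20)) ((ad E ^^ 5) T m))"
proof -
  define w where "w = witt_symbol c b"
  define N where "N k = (ad E ^^ k) T" for k
  define q where "q = b ^ 2 - 6 * b * c + 8 * c ^ 2 + 4 * c ^ 3"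
  have N: "N k ((F ^^ (k + 2)) m) = act (w k d) m" for k m
    using has_symbol_ad_power[OF E T, of k] by (simp only: has_symbol_def N_def w_def)
  have comp: "pcompose (w k d) r = w k r" for k r
    using pcompose_witt_symbol[of "[:[:0, 1:]:]" "[:0, 1:]" k d r]
    by (simp add: w_def c_def b_def d_def pcompose_pCons)
  have TN: "ad T (N k) ((F ^^ (k + 4)) m)
      = act (w 0 d * w k (d + 2) - w k d * w 0 (d + of_nat (k + 2))) m" for k m
  proof -
    have "2 + (k + 2) = k + 4" by simp
    then show ?thesis
      using has_symbol_ad[OF T has_symbol_ad_power[OF E T, of k], folded w_def N_def]
      by (simp only: has_symbol_def comp of_nat_numeral)
  qed
  have q: "act q m = 0" for m
  proof -
    have "act (48 * q) m = act (6 * (w 0 d * w 1 (d + 2) - w 1 d * w 0 (d + 3)) + w 3 d) m"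
      by (simp only: witt_symbol_degree5 q_def w_def)
    also have "\<dots> = scale 6 (ad T (N 1) ((F ^^ 5) m)) + N 3 ((F ^^ 5) m)"
      using TN[of 1 m] N[of 3 m]
      by (simp add: act.scale_left_distrib act_numeral_mult del: right_diff_distrib_numeral)
    also have "\<dots> = 0"
      using deg5 by (simp add: fun_eq_iff N_def)
    finally show ?thesis
      by (simp add: act_numeral_mult)
  qed
  have F7: "scale 20 (ad T (N 3) ((F ^^ 7) m)) + scale 3 (N 5 ((F ^^ 7) m)) = 0" for m
  proof -
    have "scale 20 (ad T (N 3) ((F ^^ 7) m)) + scale 3 (N 5 ((F ^^ 7) m))
        = act (20 * (w 0 d * w 3 (d + 2) - w 3 d * w 0 (d + 5)) + 3 * w 5 d) m"
      using TN[of 3 m] N[of 5 m]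
      by (simp add: act.scale_left_distrib act_numeral_mult del: right_diff_distrib_numeral)
    also have "\<dots> = act ((14400 * d ^ 2 + 100800 * d + 174240 - 2880 * c) * q) m"
      by (simp only: witt_symbol_degree7 q_def w_def)
    also have "\<dots> = 0"
      by (simp add: q flip: act.scale_scale)
    finally show ?thesis .
  qed
  have "ad T (N 3) x = scale (- (3/20)) (N 5 x)" for x
  proof -
    obtain m where x: "x = (F ^^ 7) m"
      using surj_fn[OF F_surj, of 7] by (metis surjD)
    have "scale (1/20) (scale 20 (ad T (N 3) x)) = scale (1/20) (- scale 3 (N 5 x))"
      using iffD2[OF eq_neg_iff_add_eq_0 F7[of m]] by (simp only: x)
    then show ?thesis by simp
  qed
  then show ?thesis by (simp add: N_def fun_eq_iff)
qed

end

section \<open>Representations from families of operators\<close>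

lemma linear_iff_add_scale:
  assumes "vector_space s"
  shows "Vector_Spaces.linear s s A \<longleftrightarrow>
    (\<forall>x y. A (x + y) = A x + A y) \<and> (\<forall>a x. A (s a x) = s a (A x))"
proof -
  interpret vector_space s by (rule assms)
  show ?thesis using assms module_axioms by (auto simp: Vector_Spaces.linear_iff module_hom_iff)
qed

lemma linear_lie_algebra:
  fixes s :: "complex \<Rightarrow> 'm::ab_group_add \<Rightarrow> 'm"
  assumes "vector_space s"
  shows "complex_lie_algebra (\<lambda>a A m. s a (A m)) {A. Vector_Spaces.linear s s A} ad"
proof -
  interpret vector_space s by (rule assms)
  interpret op: vector_space "\<lambda>a A m. s a (A m)"
    by unfold_locales
      (simp_all add: fun_eq_iff scale_right_distrib scale_left_distrib)
  note lin = linear_iff_add_scale[OF assms]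
  have diff: "A (x - y) = A x - A y" if "\<forall>x y. A (x + y) = A x + A y" for A :: "'m \<Rightarrow> 'm" and x y
    using that by (metis add_diff_cancel diff_add_cancel)
  show ?thesis
  proof unfold_locales
    show "op.subspace {A. Vector_Spaces.linear s s A}"
      by (auto simp: op.subspace_def lin scale_right_distrib scale_left_commute add_ac)
  next
    fix A B assume "A \<in> {A. Vector_Spaces.linear s s A}" "B \<in> {A. Vector_Spaces.linear s s A}"
    then show "ad A B \<in> {A. Vector_Spaces.linear s s A}"
      by (simp add: lin ad_def scale_right_diff_distrib)
  qed (auto simp: lin diff ad_def fun_eq_iff scale_right_diff_distrib)
qed

lemma witt_representation:
  fixes s :: "complex \<Rightarrow> 'm::ab_group_add \<Rightarrow> 'm" and L :: "int \<Rightarrow> 'm \<Rightarrow> 'm"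
  assumes vs: "vector_space s" and lin: "\<And>k. Vector_Spaces.linear s s (L k)"
    and rel: "\<And>i j m. i \<ge> -1 \<Longrightarrow> j \<ge> -1 \<Longrightarrow> ad (L i) (L j) m = s (of_int (i - j)) (L (i + j) m)"
  shows "\<exists>\<rho>. lie_representation witt_scale witt_pos witt_bracket s \<rho>
    \<and> (\<forall>k. \<rho> (witt_L k) = L k)"
proof -
  interpret M: vector_space s by (rule vs)
  define \<rho> where "\<rho> x m = (\<Sum>k\<in>Poly_Mapping.keys x. s (Poly_Mapping.lookup x k) (L k m))" for x m
  have L: "L k (x + y) = L k x + L k y" "L k (s a x) = s a (L k x)" for k a x y
    using lin[of k] by (simp_all add: linear_iff_add_scale[OF vs])
  have L_sum: "L k (sum g S) = (\<Sum>i\<in>S. L k (g i))" for k g and S :: "int set"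
  proof -
    have "L k 0 = 0" using L(2)[of k 0 0] by simp
    then show ?thesis by (induction S rule: infinite_finite_induct) (simp_all add: L)
  qed
  have superset: "\<rho> x m = (\<Sum>k\<in>S. s (Poly_Mapping.lookup x k) (L k m))"
    if "finite S" "Poly_Mapping.keys x \<subseteq> S" for x m S
    unfolding \<rho>_def using that by (intro sum.mono_neutral_left) (auto simp: in_keys_iff)
  have add: "\<rho> (x + y) m = \<rho> x m + \<rho> y m" for x y m
  proof -
    let ?S = "Poly_Mapping.keys x \<union> Poly_Mapping.keys y"
    have "Poly_Mapping.keys (x + y) \<subseteq> ?S" by (rule Poly_Mapping.keys_add)
    then show ?thesis
      by (simp add: superset[of ?S] lookup_add M.scale_left_distrib sum.distrib)
  qed
  have scale: "\<rho> (witt_scale a x) m = s a (\<rho> x m)" for a x m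
  proof -
    have "Poly_Mapping.keys (witt_scale a x) \<subseteq> Poly_Mapping.keys x"
      by (auto simp: in_keys_iff lookup_witt_scale)
    then show ?thesis
      by (simp add: superset[of "Poly_Mapping.keys x"] lookup_witt_scale M.scale_sum_right)
  qed
  have zero: "\<rho> 0 m = 0" for m by (simp add: \<rho>_def)
  have sum: "\<rho> (sum g S) m = (\<Sum>i\<in>S. \<rho> (g i) m)" for g m and S :: "int set"
    by (induction S rule: infinite_finite_induct) (simp_all add: zero add)
  have single: "\<rho> (Poly_Mapping.single k a) m = s a (L k m)" for k a m
    by (subst superset[of "{k}"]) (auto simp: in_keys_iff lookup_single)
  have bracket: "\<rho> (witt_bracket x y) = ad (\<rho> x) (\<rho> y)" if "x \<in> witt_pos" "y \<in> witt_pos" for x y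
  proof
    fix m
    let ?X = "Poly_Mapping.keys x" and ?Y = "Poly_Mapping.keys y"
    let ?x = "Poly_Mapping.lookup x" and ?y = "Poly_Mapping.lookup y"
    have "\<rho> (witt_bracket x y) m
        = (\<Sum>i\<in>?X. \<Sum>j\<in>?Y. s (?x i * ?y j) (s (of_int (i - j)) (L (i + j) m)))"
      by (simp add: witt_bracket_def sum single mult_ac)
    also have "\<dots> = (\<Sum>i\<in>?X. \<Sum>j\<in>?Y. s (?x i * ?y j) (ad (L i) (L j) m))"
    proof (intro sum.cong refl)
      fix i j assume "i \<in> ?X" "j \<in> ?Y"
      then have "i \<ge> -1" "j \<ge> -1" using that by (auto simp: witt_pos_def)
      then show "s (?x i * ?y j) (s (of_int (i - j)) (L (i + j) m)) = s (?x i * ?y j) (ad (L i) (L j) m)"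
        by (simp only: rel)
    qed
    also have "\<dots> = (\<Sum>i\<in>?X. \<Sum>j\<in>?Y. s (?x i * ?y j) (L i (L j m)))
        - (\<Sum>i\<in>?X. \<Sum>j\<in>?Y. s (?x i * ?y j) (L j (L i m)))"
      by (simp add: ad_def M.scale_right_diff_distrib sum_subtractf)
    also have "(\<Sum>i\<in>?X. \<Sum>j\<in>?Y. s (?x i * ?y j) (L i (L j m))) = \<rho> x (\<rho> y m)"
      by (simp add: \<rho>_def L_sum L M.scale_sum_right)
    also have "(\<Sum>i\<in>?X. \<Sum>j\<in>?Y. s (?x i * ?y j) (L j (L i m))) = \<rho> y (\<rho> x m)"
      by (subst sum.swap) (simp add: \<rho>_def L_sum L M.scale_sum_right mult.commute)
    finally show "\<rho> (witt_bracket x y) m = ad (\<rho> x) (\<rho> y) m" by (simp add: ad_def)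
  qed
  have "Vector_Spaces.linear s s (\<rho> x)" for x
    by (simp add: linear_iff_add_scale[OF vs] \<rho>_def L M.scale_right_distrib sum.distrib
        M.scale_sum_right mult.commute)
  then have "lie_representation witt_scale witt_pos witt_bracket s \<rho>"
    using witt_pos_lie_algebra vs bracket
    by (simp add: lie_representation_def lie_representation_axioms_def add scale fun_eq_iff)
  moreover have "\<rho> (witt_L k) = L k" for k
    by (simp add: fun_eq_iff witt_L_def single)
  ultimately show ?thesis by blast
qed

section \<open>Weight modules with prescribed Casimir eigenvalue\<close>

text \<open>
  Adding a nonzero scalar to an operator that is nilpotent on the orbit of \<open>m\<close> makes it solvable
  at \<open>m\<close>, without leaving an invariant subspace: solve at \<open>N m\<close> first, where the order of
  nilpotency is smaller.
\<close>

lemma nilpotent_plus_scalar_surj: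
  fixes s :: "complex \<Rightarrow> 'm::ab_group_add \<Rightarrow> 'm"
  assumes vs: "vector_space s" and N: "Vector_Spaces.linear s s N" and a: "a \<noteq> 0"
    and nil: "(N ^^ n) m = 0" and m: "m \<in> W"
    and W: "module.subspace s W" "\<And>v. v \<in> W \<Longrightarrow> N v \<in> W"
  shows "\<exists>v\<in>W. N v + s a v = m"
  using nil m
proof (induction n arbitrary: m)
  case 0
  interpret N: Vector_Spaces.linear s s N by (rule N)
  show ?case using 0 by (intro bexI[of _ 0]) (simp_all add: N.zero)
next
  case (Suc n)
  interpret vector_space s by (rule vs)
  interpret N: Vector_Spaces.linear s s N by (rule N)
  obtain u where u: "u \<in> W" "N u + s a u = N m"
    using Suc.IH[of "N m"] Suc.prems W(2) by (auto simp: funpow_swap1)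
  let ?v = "s (1 / a) (m - u)"
  have "?v \<in> W"
    using W(1) u(1) Suc.prems by (intro subspace_scale subspace_diff)
  moreover have "N ?v + s a ?v = m"
  proof -
    have "N ?v = s (1 / a) (N m - N u)" by (simp add: N.scale N.diff)
    also have "N m - N u = s a u" using u(2) by (simp add: algebra_simps)
    finally show ?thesis using a by simp
  qed
  ultimately show ?case by blast
qed

lemma chevalley_in_sl2: "sl2_e \<in> sl2" "sl2_f \<in> sl2" "sl2_h \<in> sl2"
  by (simp_all add: sl2_def sl2_e_def sl2_f_def sl2_h_def trace_def sum_2)

lemma sl2_module_relations:
  assumes "lie_representation mat_scale sl2 mat_bracket s \<sigma>"
  shows "\<sigma> sl2_e (\<sigma> sl2_f m) = \<sigma> sl2_f (\<sigma> sl2_e m) + \<sigma> sl2_h m"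
    and "\<sigma> sl2_h (\<sigma> sl2_e m) = \<sigma> sl2_e (\<sigma> sl2_h m) + s 2 (\<sigma> sl2_e m)"
    and "\<sigma> sl2_h (\<sigma> sl2_f m) = \<sigma> sl2_f (\<sigma> sl2_h m) - s 2 (\<sigma> sl2_f m)"
proof -
  interpret lie_representation mat_scale sl2 mat_bracket s \<sigma> by (rule assms)
  note [simp] = chevalley_in_sl2
  have "ad (\<sigma> sl2_e) (\<sigma> sl2_f) m = \<sigma> sl2_h m"
    by (simp add: sl2_relations flip: rep_bracket)
  then show "\<sigma> sl2_e (\<sigma> sl2_f m) = \<sigma> sl2_f (\<sigma> sl2_e m) + \<sigma> sl2_h m"
    by (simp add: ad_def algebra_simps)
  have "ad (\<sigma> sl2_h) (\<sigma> sl2_e) m = s 2 (\<sigma> sl2_e m)"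
    by (simp add: sl2_relations rep_scale flip: rep_bracket)
  then show "\<sigma> sl2_h (\<sigma> sl2_e m) = \<sigma> sl2_e (\<sigma> sl2_h m) + s 2 (\<sigma> sl2_e m)"
    by (simp add: ad_def algebra_simps)
  have "ad (\<sigma> sl2_h) (\<sigma> sl2_f) m = s (- 2) (\<sigma> sl2_f m)"
    by (simp add: sl2_relations rep_scale del: scale_minus_left flip: rep_bracket)
  then show "\<sigma> sl2_h (\<sigma> sl2_f m) = \<sigma> sl2_f (\<sigma> sl2_h m) - s 2 (\<sigma> sl2_f m)"
    by (simp add: ad_def algebra_simps)
qed

text \<open>
  On the weight space of weight \<open>\<mu>\<close>, \<open>4 f e\<close> equals the Casimir operator minus \<open>(\<mu> + 1)\<^sup>2\<close>, which is
  the nonzero scalar \<open>\<tau> - (\<mu> + 1)\<^sup>2\<close> plus a nilpotent operator. So every weight vector lies in the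
  image of \<open>f\<close>.
\<close>

lemma lowering_operator_surj:
  assumes obj: "Mbar_object s \<sigma> \<xi> \<tau>" and \<tau>: "\<forall>\<mu>\<in>\<xi>. \<tau> \<noteq> (\<mu> + 1) ^ 2"
  shows "surj (\<sigma> sl2_f)"
proof -
  have rep: "lie_representation mat_scale sl2 mat_bracket s \<sigma>"
    using obj by (simp add: Mbar_object_def)
  interpret lie_representation mat_scale sl2 mat_bracket s \<sigma> by (rule rep)
  let ?e = "\<sigma> sl2_e" and ?f = "\<sigma> sl2_f" and ?h = "\<sigma> sl2_h"
  have lin: "Vector_Spaces.linear s s ?e" "Vector_Spaces.linear s s ?f"
    "Vector_Spaces.linear s s ?h"
    by (simp_all add: rep_End chevalley_in_sl2)
  interpret e: Vector_Spaces.linear s s ?e by (rule lin)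
  interpret f: Vector_Spaces.linear s s ?f by (rule lin)
  interpret h: Vector_Spaces.linear s s ?h by (rule lin)
  note rel = sl2_module_relations[OF rep]
  have cas: "casimir s \<sigma> m = ?h (?h m) + s 2 (?h m) + m + s 4 (?f (?e m))" for m
    using M.scale_left_distrib[of 1 1 "?h m"]
    by (simp add: casimir_def numeral_2_eq_2 h.add algebra_simps)
  have weight: "m \<in> range ?f" if m: "m \<in> weight_space s \<sigma> \<mu>" for m \<mu>
  proof (cases "m = 0")
    case True
    then show ?thesis using f.zero by (metis rangeI)
  next
    case False
    have "0 \<in> weight_space s \<sigma> \<mu>" by (simp add: weight_space_def h.zero)
    then have "\<mu> \<in> weight_supp s \<sigma>" using False m by (auto simp: weight_supp_def)
    then have "\<mu> \<in> \<xi>" using obj by (auto simp: Mbar_object_def)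
    then obtain n where n: "((\<lambda>v. casimir s \<sigma> v - s \<tau> v) ^^ n) m = 0"
      using obj m unfolding Mbar_object_def by blast
    have a: "\<tau> - (\<mu> + 1) ^ 2 \<noteq> 0" using \<tau> \<open>\<mu> \<in> \<xi>\<close> by simp
    have "\<exists>v\<in>weight_space s \<sigma> \<mu>. (casimir s \<sigma> v - s \<tau> v) + s (\<tau> - (\<mu> + 1) ^ 2) v = m"
    proof (rule nilpotent_plus_scalar_surj[OF M.vector_space_axioms _ a n m])
      show "Vector_Spaces.linear s s (\<lambda>v. casimir s \<sigma> v - s \<tau> v)"
        by (simp add: linear_iff_add_scale[OF M.vector_space_axioms] cas e.add e.scale f.add f.scale
            h.add h.scale M.scale_right_distrib M.scale_right_diff_distrib mult.commute
            algebra_simps)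
      show "M.subspace (weight_space s \<sigma> \<mu>)"
        by (auto simp: M.subspace_def weight_space_def h.zero h.add h.scale
            M.scale_right_distrib mult.commute)
      show "casimir s \<sigma> v - s \<tau> v \<in> weight_space s \<sigma> \<mu>" if "v \<in> weight_space s \<sigma> \<mu>" for v
        using that
        by (simp add: weight_space_def cas rel h.add h.diff h.scale e.add e.scale f.add f.scale
            M.scale_right_distrib M.scale_right_diff_distrib mult.commute)
    qed
    then obtain v where v: "?h v = s \<mu> v" "casimir s \<sigma> v - s ((\<mu> + 1) ^ 2) v = m"
      by (auto simp: weight_space_def M.scale_left_diff_distrib)
    have "casimir s \<sigma> v - s ((\<mu> + 1) ^ 2) v = s 4 (?f (?e v))"
      by (simp add: cas v(1) h.scale power2_eq_square M.scale_left_distrib algebra_simps)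
    then have "m = ?f (s 4 (?e v))" using v(2) by (simp add: f.scale)
    then show ?thesis by blast
  qed
  have "m \<in> range ?f" for m
  proof -
    obtain w where w: "\<forall>\<mu>. w \<mu> \<in> weight_space s \<sigma> \<mu>" "m = (\<Sum>\<mu> | w \<mu> \<noteq> 0. w \<mu>)"
      using obj unfolding Mbar_object_def weight_module_def by blast
    have "\<exists>u. ?f u = w \<mu>" for \<mu>
      using weight[of "w \<mu>" \<mu>] w(1) by (metis rangeE)
    then obtain u where "\<And>\<mu>. ?f (u \<mu>) = w \<mu>" by metis
    then have "m = ?f (\<Sum>\<mu> | w \<mu> \<noteq> 0. u \<mu>)" using w(2) by (simp add: f.sum)
    then show ?thesis by blast
  qed
  then show ?thesis by auto
qed

section \<open>Extending the action\<close>

text \<open>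
  The hypotheses on \<open>T\<close> produce the data of the symbol calculus. The operator \<open>C\<close> is determined by
  \<open>e f\<close> and equals \<open>(1 - c) / 4\<close> for the Casimir operator \<open>c\<close>. The operator \<open>B\<close> is what remains of \<open>T f\<^sup>2\<close>
  after subtracting the cubic polynomial in \<open>D\<close> that accounts for \<open>[f, T] = 3 e\<close>; therefore it
  commutes with \<open>f\<close>. It commutes with \<open>D\<close> because \<open>T\<close> has weight 4, and with \<open>C\<close> because \<open>T\<close>
  commutes with the Casimir operator.
\<close>

lemma degree7_relation_of_sl2_compatible:
  fixes s :: "complex \<Rightarrow> 'm::ab_group_add \<Rightarrow> 'm"
  assumes rep: "lie_representation mat_scale sl2 mat_bracket s \<sigma>"
    and T: "Vector_Spaces.linear s s T"
    and fT: "ad (\<sigma> sl2_f) T = (\<lambda>m. s 3 (\<sigma> sl2_e m))"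
    and hT: "ad (\<sigma> sl2_h) T = (\<lambda>m. s 4 (T m))"
    and cT: "ad (casimir s \<sigma>) T = (\<lambda>m. 0)"
    and surj: "surj (\<sigma> sl2_f)"
    and deg5: "ad T (ad (\<sigma> sl2_e) T) = (\<lambda>m. s (- (1/6)) ((ad (\<sigma> sl2_e) ^^ 3) T m))"
  shows "ad T ((ad (\<sigma> sl2_e) ^^ 3) T) = (\<lambda>m. s (- (3/20)) ((ad (\<sigma> sl2_e) ^^ 5) T m))"
proof -
  interpret lie_representation mat_scale sl2 mat_bracket s \<sigma> by (rule rep)
  define e where "e = \<sigma> sl2_e"
  define f where "f = \<sigma> sl2_f"
  define D where "D m = s (- (1/2)) (\<sigma> sl2_h m)" for m
  define C where "C m = - e (f m) - D (D m) - D m" for m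
  define B where "B m = T (f (f m))
    - (D (D (D m)) + s 3 (D (D m)) + s 2 (D m) + s 3 (C (D m)))" for m
  have lin: "Vector_Spaces.linear s s e" "Vector_Spaces.linear s s f"
    "Vector_Spaces.linear s s (\<sigma> sl2_h)"
    by (simp_all add: e_def f_def rep_End chevalley_in_sl2)
  interpret e: Vector_Spaces.linear s s e by (rule lin)
  interpret f: Vector_Spaces.linear s s f by (rule lin)
  interpret h: Vector_Spaces.linear s s "\<sigma> sl2_h" by (rule lin)
  interpret T: Vector_Spaces.linear s s T by (rule T)
  have vs: "vector_space s" by (rule M.vector_space_axioms)
  have D_add: "D (x + y) = D x + D y" and D_scale: "D (s a x) = s a (D x)" for x y a
    by (simp_all add: D_def h.add h.scale M.scale_right_distrib mult.commute)
  interpret D: Vector_Spaces.linear s s D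
    by (simp add: linear_iff_add_scale[OF vs] D_add D_scale)
  have h: "\<sigma> sl2_h m = - D m - D m" for m
    by (simp add: D_def flip: M.scale_left_distrib)
  \<comment> \<open>Multiples are expanded into sums so that the commutation relations below become identities
    in an abelian group.\<close>
  have multiples: "s 2 x = x + x" "s 3 x = x + x + x" "s 4 x = x + x + x + x" for x
    using M.scale_left_distrib[of 1 1 x] M.scale_left_distrib[of 2 1 x]
      M.scale_left_distrib[of 3 1 x] by simp_all
  note sl2_rel = sl2_module_relations[OF rep, folded e_def f_def]
  have De: "D (e m) = e (D m) - e m" for m
    by (simp add: D_def sl2_rel(2) M.scale_right_distrib e.scale e.neg)
  have Df: "D (f m) = f (D m) + f m" for m
    by (simp add: D_def sl2_rel(3) M.scale_right_diff_distrib f.scale f.neg)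
  have ef: "e (f m) = - C m - D (D m) - D m" for m
    by (simp add: C_def)
  have DT: "D (T m) = T (D m) - T m - T m" for m
  proof -
    have "\<sigma> sl2_h (T m) = T (\<sigma> sl2_h m) + s 4 (T m)"
      using fun_cong[OF hT, of m] by (simp add: ad_def algebra_simps)
    then show ?thesis by (simp add: D_def M.scale_right_distrib T.scale T.neg multiples(1))
  qed
  have Tf: "T (f m) = f (T m) - s 3 (e m)" for m
    using fun_cong[OF fT, of m] by (simp add: ad_def e_def f_def algebra_simps)
  have casimir: "casimir s \<sigma> m = m - s 4 (C m)" for m
  proof -
    have "f (e m) = e (f m) + D m + D m"
      using sl2_rel(1)[of m] by (simp add: h)
    then have "s 4 (f (e m)) = s 4 (e (f m)) + s 4 (D m) + s 4 (D m)"
      by (simp add: M.scale_right_distrib)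
    then show ?thesis
      by (simp add: casimir_def numeral_2_eq_2 flip: e_def f_def)
        (simp add: h ef multiples D.add D.diff D.neg algebra_simps)
  qed
  have CT: "C (T m) = T (C m)" for m
  proof -
    have "s 4 (C (T m)) = s 4 (T (C m))"
      using fun_cong[OF cT, of m] by (simp add: ad_def casimir T.diff T.scale)
    then show ?thesis by simp
  qed
  have C_add: "C (x + y) = C x + C y" and C_scale: "C (s a x) = s a (C x)" for x y a
    by (simp_all add: C_def e.add f.add D.add e.scale f.scale D.scale
        M.scale_right_diff_distrib algebra_simps)
  interpret C: Vector_Spaces.linear s s C
    by (simp add: linear_iff_add_scale[OF vs] C_add C_scale)
  have DC: "D (C m) = C (D m)" for m
    by (simp add: C_def De Df D.add D.diff D.neg e.add e.diff f.add algebra_simps)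
  have FC: "f (C m) = C (f m)" for m
  proof -
    have "e (f (f m)) = f (e (f m)) - D (f m) - D (f m)"
      using sl2_rel(1)[of "f m"] by (simp add: h)
    then show ?thesis
      by (simp add: C_def Df D.add f.add f.diff f.neg algebra_simps)
  qed
  have B_add: "B (x + y) = B x + B y" and B_scale: "B (s a x) = s a (B x)" for x y a
    by (simp_all add: B_def T.add f.add D.add C.add T.scale f.scale D.scale C.scale
        M.scale_right_diff_distrib M.scale_right_distrib mult.commute algebra_simps)
  interpret B: Vector_Spaces.linear s s B
    by (simp add: linear_iff_add_scale[OF vs] B_add B_scale)
  have BC: "B (C m) = C (B m)" for m
    by (simp add: B_def C.add C.diff C.scale CT DC flip: FC)
  have DB: "D (B m) = B (D m)" for m
    by (simp add: B_def multiples D.add D.diff DT Df DC T.add f.add algebra_simps)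
  have FB: "f (B m) = B (f m)" for m
  proof -
    have "T (f (f (f m))) = f (T (f (f m))) - s 3 (e (f (f m)))"
      by (rule Tf)
    then show ?thesis
      by (simp add: B_def multiples ef Df f.add f.diff D.add C.add FC[symmetric] algebra_simps)
  qed
  interpret symbol_calculus s C B D f
    using DC FC BC DB FB Df surj C.module_hom_axioms B.module_hom_axioms D.module_hom_axioms
      f.module_hom_axioms
    by unfold_locales (simp_all add: f_def)
  have "has_symbol 1 e (- (d ^ 2 + d + c))"
    by (simp add: has_symbol_def act.scale_left_distrib act.scale_left_diff_distrib act_c act_d
        power2_eq_square ef algebra_simps flip: act.scale_scale)
  moreover have "has_symbol 2 T (witt_symbol c b 0 d)"
    by (simp add: has_symbol_def numeral_2_eq_2 act.scale_left_distrib act_b act_c act_d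
        act_numeral B_def power2_eq_square power3_eq_cube distrib_right flip: act.scale_scale)
  ultimately show ?thesis
    using degree7_from_degree5[of e T] deg5 by (simp add: e_def)
qed

theorem theorem4p7:
  fixes \<xi> :: "complex set"
    and \<tau> :: complex
    and scaleM :: "complex \<Rightarrow> 'm::ab_group_add \<Rightarrow> 'm"
    and \<sigma> :: "complex^2^2 \<Rightarrow> 'm \<Rightarrow> 'm"
    and T :: "'m \<Rightarrow> 'm"
  assumes "\<xi> \<in> UNIV // cong_2Z"
    and "\<forall>\<mu>\<in>\<xi>. \<tau> \<noteq> (\<mu> + 1)^2"
    and "\<tau> \<noteq> 0"
    and "Mbar_object scaleM \<sigma> \<xi> \<tau>"
    and "Vector_Spaces.linear scaleM scaleM T"
    and "ad (\<sigma> sl2_f) T = (\<lambda>m. scaleM 3 (\<sigma> sl2_e m))"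
    and "ad (\<sigma> sl2_h) T = (\<lambda>m. scaleM 4 (T m))"
    and "ad (casimir scaleM \<sigma>) T = (\<lambda>m. 0)"
    and "ad T (ad (\<sigma> sl2_e) T) = (\<lambda>m. scaleM (- (1/6)) ((ad (\<sigma> sl2_e) ^^ 3) T m))"
  shows "\<exists>\<rho>. lie_representation witt_scale witt_pos witt_bracket scaleM \<rho>
    \<and> \<rho> (witt_L (- 1)) = \<sigma> sl2_f
    \<and> \<rho> (witt_L 0) = (\<lambda>m. scaleM (- (1/2)) (\<sigma> sl2_h m))
    \<and> \<rho> (witt_L 1) = (\<lambda>m. - \<sigma> sl2_e m)
    \<and> \<rho> (witt_L 2) = T"
proof -
  have rep: "lie_representation mat_scale sl2 mat_bracket scaleM \<sigma>"
    using assms(4) by (simp add: Mbar_object_def)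
  interpret lie_representation mat_scale sl2 mat_bracket scaleM \<sigma> by (rule rep)
  have vs: "vector_space scaleM" by (rule M.vector_space_axioms)
  interpret gl: complex_lie_algebra "\<lambda>a A m. scaleM a (A m)"
      "{A. Vector_Spaces.linear scaleM scaleM A}" ad
    by (rule linear_lie_algebra[OF vs])
  let ?e = "\<sigma> sl2_e" and ?f = "\<sigma> sl2_f" and ?h = "\<sigma> sl2_h"
  have lin: "Vector_Spaces.linear scaleM scaleM ?e" "Vector_Spaces.linear scaleM scaleM ?f"
    "Vector_Spaces.linear scaleM scaleM ?h"
    by (simp_all add: rep_End chevalley_in_sl2)
  define N where "N n = (ad ?e ^^ n) T" for n
  \<comment> \<open>Since \<open>L\<^sub>1 = - e\<close>, the ladder relation forces \<open>L\<^sub>k = ad(e)\<^sup>k\<^sup>-\<^sup>2 T / (k - 2)!\<close> for \<open>k \<ge> 2\<close>.\<close>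
  define L :: "int \<Rightarrow> 'm \<Rightarrow> 'm" where
    "L k = (if k < - 1 then (\<lambda>m. 0) else if k = - 1 then ?f
       else if k = 0 then (\<lambda>m. scaleM (- (1/2)) (?h m)) else if k = 1 then (\<lambda>m. - ?e m)
       else (\<lambda>m. scaleM (1 / fact (nat (k - 2))) (N (nat (k - 2)) m)))" for k
  have N_lin: "Vector_Spaces.linear scaleM scaleM (N n)" for n
  proof (induction n)
    case 0
    show ?case using assms(5) by (simp add: N_def)
  next
    case (Suc n)
    then show ?case using gl.bracket_closed[of ?e "N n"] lin(1) by (simp add: N_def)
  qed
  have L_lin: "Vector_Spaces.linear scaleM scaleM (L k)" for k
    using N_lin lin
    by (auto simp: L_def linear_iff_add_scale[OF vs] M.scale_right_distrib mult.commute)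
  have defect: "gl.witt_defect L i j = 0
      \<longleftrightarrow> (\<forall>m. ad (L i) (L j) m = scaleM (of_int (i - j)) (L (i + j) m))" for i j
    unfolding gl.witt_defect_def by (simp add: fun_eq_iff del: of_int_diff)
  interpret e: Vector_Spaces.linear scaleM scaleM ?e by (rule lin)
  interpret f: Vector_Spaces.linear scaleM scaleM ?f by (rule lin)
  interpret h: Vector_Spaces.linear scaleM scaleM ?h by (rule lin)
  interpret T: Vector_Spaces.linear scaleM scaleM T by (rule assms(5))
  note sl2_rel = sl2_module_relations[OF rep]
  have fT: "?f (T m) = T (?f m) + scaleM 3 (?e m)" and hT: "?h (T m) = T (?h m) + scaleM 4 (T m)" for m
    using fun_cong[OF assms(6), of m] fun_cong[OF assms(7), of m]
    by (simp_all add: ad_def algebra_simps)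
  have deg7: "ad T (N 3) = (\<lambda>m. scaleM (- (3/20)) (N 5 m))"
    unfolding N_def
    by (rule degree7_relation_of_sl2_compatible[OF rep assms(5-8) lowering_operator_surj[OF assms(4,2)] assms(9)])
  have ladder: "?e (N n m) - N n (?e m) = N (Suc n) m" for n m
    by (simp add: N_def ad_def)
  have N_scale: "N n (scaleM a m) = scaleM a (N n m)" and N_minus: "N n (- m) = - N n m" for n a m
    using N_lin[of n] by (simp_all add: linear_iff_add_scale[OF vs]) (metis M.scale_minus_left M.scale_one)
  have "gl.witt_defect L i j = 0" if "i \<ge> -1" "j \<ge> -1" for i j
  proof (rule gl.witt_relations_from_degrees_5_and_7[OF _ _ _ _ _ _ _ _ _ that])
    show "L k \<in> {A. Vector_Spaces.linear scaleM scaleM A}" for k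
      using L_lin by simp
    show "gl.witt_defect L (-1) 0 = 0"
      by (simp add: defect L_def ad_def sl2_rel f.scale f.neg M.scale_right_diff_distrib)
    show "gl.witt_defect L (-1) 1 = 0"
      by (simp add: defect L_def ad_def sl2_rel f.neg)
    show "gl.witt_defect L 0 1 = 0"
      by (simp add: defect L_def ad_def sl2_rel e.scale e.neg h.neg M.scale_right_distrib
          M.scale_right_diff_distrib)
    show "gl.witt_defect L (-1) 2 = 0"
      by (simp add: defect L_def ad_def N_def fT)
    show "gl.witt_defect L 0 2 = 0"
      by (simp add: defect L_def ad_def N_def hT T.scale T.neg M.scale_right_distrib)
    show "gl.witt_defect L 1 k = 0" if "k \<ge> 2" for k
    proof -
      define n where "n = nat (k - 2)"
      have k: "k = int n + 2" using that by (simp add: n_def)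
      have "ad (L 1) (L k) m = - scaleM (1 / fact n) (?e (N n m) - N n (?e m))" for m
        by (simp add: k L_def ad_def e.scale N_minus M.scale_right_diff_distrib)
      moreover have "L (1 + k) m = scaleM (1 / fact (Suc n)) (N (Suc n) m)" for m
        by (simp add: k L_def nat_add_distrib Suc_nat_eq_nat_zadd1)
      moreover have "of_int (1 - k) * (1 / fact (Suc n)) = - (1 / fact n :: complex)"
      proof -
        have "of_int (1 - k) = - (of_nat (Suc n) :: complex)" by (simp add: k)
        then show ?thesis by (simp add: fact_Suc del: of_nat_Suc)
      qed
      ultimately show ?thesis by (simp add: defect ladder del: of_int_diff fact_Suc)
    qed
    show "gl.witt_defect L 2 3 = 0"
      using fun_cong[OF assms(9)] by (simp add: defect L_def N_def fact_numeral)
    show "gl.witt_defect L 2 5 = 0"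
    proof -
      have "ad T (\<lambda>m. scaleM (1/6) (N 3 m)) m = scaleM (1/6) (ad T (N 3) m)" for m
        by (simp add: ad_def T.scale M.scale_right_diff_distrib)
      then show ?thesis by (simp add: defect L_def deg7 fact_numeral) (simp add: N_def deg7)
    qed
  qed
  then obtain \<rho> where "lie_representation witt_scale witt_pos witt_bracket scaleM \<rho>"
    "\<And>k. \<rho> (witt_L k) = L k"
    using witt_representation[OF vs, of L] L_lin defect by metis
  then show ?thesis
    by (intro exI[of _ \<rho>]) (simp add: L_def N_def)
qed

end
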